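(* Let $T : X \to X$ be a chaotic unilateral weighted backward shift on a sequence $F$-space $X \subset \mathbb{K}^{\mathbb{N}}$ in which the canonical unit vectors $(e_n)_{n\in\mathbb{N}}$ form an unconditional basis. Then there exists a $T$-invariant exact Borel probability measure on $X$ with full support.
   Context: $\mathbb{K}$ denotes the scalar field ($\mathbb{R}$ or $\mathbb{C}$). An $F$-space is a topological vector space over $\mathbb{K}$ whose topology is induced by a complete translation-invariant metric. A sequence $F$-space (indexed by $\mathbb{N}=\{1,2,\dots\}$) is an $F$-space $X$ that is a linear subspace of $\mathbb{K}^{\mathbb{N}}$ with continuous inclusion, where $\mathbb{K}^{\mathbb{N}}$ carries the product topology. Given a sequence $w=(w_n)_n$ of non-zero weights in $\mathbb{K}$, the unilateral weighted backward shift is $B_w(x_1,x_2,x_3,\dots) = (w_2x_2, w_3x_3,\dots)$. A unilateral weighted backward shift on $X$ is the restriction $T = B_w|_X$ for some such $w$ with $B_w(X) \subset X$; it is then automatically continuous on $X$ by the closed graph theorem. The vector $e_n$ is the sequence with $1$ in position $n$ and $0$ elsewhere. $(e_n)_{n\in\mathbb{N}}$ is an unconditional basis of $X$ if all $e_n \in X$ and, for every $x=(x_n)_n \in X$, the series $\sum_{n} x_n e_n$ converges unconditionally to $x$ in $X$. A series $\sum_n y_n$ converges unconditionally if it converges and for any $0$-neighbourhood $U$ there is $N$ such that $\sum_{n\in F} y_n\in U$ for every finite $F\subset\{N,N+1,\dots\}$. An operator $T$ on $X$ is chaotic (in the sense of Devaney) if it is hypercyclic (some $x\in X$ has dense orbit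 $\{x,Tx,T^2x,\dots\}$) and its set of periodic points is dense in $X$. Let $\mathfrak{B}$ be the Borel $\sigma$-algebra of $X$ and $\mu$ a Borel probability measure on $X$. The measure $\mu$ has full support if $\mu(U)>0$ for each non-empty open $U\subset X$. It is $T$-invariant if $\mu(T^{-1}(A))=\mu(A)$ for all $A\in\mathfrak{B}$. A $T$-invariant $\mu$ is called exact if $T$ is exact with respect to $\mu$, i.e. every $A \in \bigcap_{n=0}^\infty T^{-n}\mathfrak{B}$ satisfies $\mu(A)=0$ or $\mu(A)=1$. *)

theory Defs
  imports "HOL-Probability.Probability" "HOL-Library.Function_Algebras"
begin

section \<open>The scalar field\<close>

text \<open>
  The scalar field is \<open>\<real>\<close> or \<open>\<complex>\<close>. Both are instances of the following class. They are the only
  ones up to isometric isomorphism: an instance is a finite-dimensional commutative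
  division algebra over \<open>\<real>\<close>, hence \<open>\<real>\<close> or \<open>\<complex>\<close> by Frobenius' theorem, and its norm is
  multiplicative, hence the usual absolute value.
\<close>

class real_or_complex = real_normed_field + euclidean_space

instance real :: real_or_complex ..
instance complex :: real_or_complex ..

section \<open>F-spaces\<close>

text \<open>
  Spaces are given by an abstract topology \<open>\<tau>\<close> whose carrier \<open>topspace \<tau>\<close> is a linear subspace
  of an ambient vector space.
\<close>

locale topological_vector_space_on = vector_space scale
  for scale :: "'k::real_or_complex \<Rightarrow> 'v::ab_group_add \<Rightarrow> 'v" +
  fixes \<tau> :: "'v topology"
  assumes subspace_topspace: "subspace (topspace \<tau>)"
    and continuous_add: "continuous_map (prod_topology \<tau> \<tau>) \<tau> (\<lambda>(x, y). x + y)"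
    and continuous_scale: "continuous_map (prod_topology euclidean \<tau>) \<tau> (\<lambda>(c, x). scale c x)"

locale F_space = topological_vector_space_on scale \<tau>
  for scale :: "'k::real_or_complex \<Rightarrow> 'v::ab_group_add \<Rightarrow> 'v" and \<tau> :: "'v topology" +
  assumes complete_invariant_metric:
    "\<exists>d. Metric_space (topspace \<tau>) d \<and> Metric_space.mtopology (topspace \<tau>) d = \<tau> \<and>
         Metric_space.mcomplete (topspace \<tau>) d \<and>
         (\<forall>x\<in>topspace \<tau>. \<forall>y\<in>topspace \<tau>. \<forall>z\<in>topspace \<tau>. d (x + z) (y + z) = d x y)"

section \<open>Sequence F-spaces\<close>

text \<open>
  Sequences are indexed from \<open>0\<close>: the coordinate written \<open>x\<^sub>n\<close> with \<open>n \<ge> 1\<close> in the usual notation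
  is \<open>x (n - 1)\<close> here.
\<close>

definition seq_scale :: "'k::real_or_complex \<Rightarrow> (nat \<Rightarrow> 'k) \<Rightarrow> nat \<Rightarrow> 'k" where
  "seq_scale c x = (\<lambda>n. c * x n)"

locale sequence_F_space = F_space seq_scale \<tau>
  for \<tau> :: "(nat \<Rightarrow> 'k::real_or_complex) topology" +
  assumes continuous_inclusion:
    "continuous_map \<tau> (product_topology (\<lambda>_. euclidean) UNIV) (\<lambda>x. x)"

definition unit_seq :: "nat \<Rightarrow> nat \<Rightarrow> 'k::real_or_complex" where
  "unit_seq n = (\<lambda>k. if k = n then 1 else 0)"

definition converges_unconditionally_to ::
    "'v::ab_group_add topology \<Rightarrow> (nat \<Rightarrow> 'v) \<Rightarrow> 'v \<Rightarrow> bool" where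
  "converges_unconditionally_to \<tau> y s \<longleftrightarrow>
     limitin \<tau> (\<lambda>N. \<Sum>n<N. y n) s sequentially \<and>
     (\<forall>U. openin \<tau> U \<and> 0 \<in> U \<longrightarrow>
        (\<exists>N. \<forall>F. finite F \<and> F \<subseteq> {N..} \<longrightarrow> (\<Sum>n\<in>F. y n) \<in> U))"

definition unit_seqs_unconditional_basis ::
    "(nat \<Rightarrow> 'k::real_or_complex) topology \<Rightarrow> bool" where
  "unit_seqs_unconditional_basis \<tau> \<longleftrightarrow>
     (\<forall>n. unit_seq n \<in> topspace \<tau>) \<and>
     (\<forall>x\<in>topspace \<tau>.
        converges_unconditionally_to \<tau> (\<lambda>n. seq_scale (x n) (unit_seq n)) x)"

section \<open>Weighted shifts and chaos\<close>

text \<open>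
  Operators on a space with topology \<open>\<tau>\<close> are functions on the ambient type; only their values on
  \<open>topspace \<tau>\<close> matter.
\<close>

definition weighted_backward_shift ::
    "(nat \<Rightarrow> 'k::real_or_complex) \<Rightarrow> (nat \<Rightarrow> 'k) \<Rightarrow> nat \<Rightarrow> 'k" where
  "weighted_backward_shift w x = (\<lambda>n. w (Suc n) * x (Suc n))"

definition is_weighted_backward_shift_on ::
    "(nat \<Rightarrow> 'k::real_or_complex) topology \<Rightarrow> ((nat \<Rightarrow> 'k) \<Rightarrow> nat \<Rightarrow> 'k) \<Rightarrow> bool" where
  "is_weighted_backward_shift_on \<tau> T \<longleftrightarrow>
     (\<exists>w. (\<forall>n. w n \<noteq> 0) \<and>
          weighted_backward_shift w ` topspace \<tau> \<subseteq> topspace \<tau> \<and>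
          (\<forall>x\<in>topspace \<tau>. T x = weighted_backward_shift w x))"

definition hypercyclic_on :: "'v topology \<Rightarrow> ('v \<Rightarrow> 'v) \<Rightarrow> bool" where
  "hypercyclic_on \<tau> T \<longleftrightarrow>
     (\<exists>x\<in>topspace \<tau>. \<tau> closure_of (range (\<lambda>n. (T ^^ n) x)) = topspace \<tau>)"

definition periodic_points_on :: "'v topology \<Rightarrow> ('v \<Rightarrow> 'v) \<Rightarrow> 'v set" where
  "periodic_points_on \<tau> T = {x \<in> topspace \<tau>. \<exists>n\<ge>1. (T ^^ n) x = x}"

definition chaotic_on :: "'v topology \<Rightarrow> ('v \<Rightarrow> 'v) \<Rightarrow> bool" where
  "chaotic_on \<tau> T \<longleftrightarrow>
     hypercyclic_on \<tau> T \<and> \<tau> closure_of (periodic_points_on \<tau> T) = topspace \<tau>"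

section \<open>Invariant and exact measures\<close>

definition borel_of :: "'v topology \<Rightarrow> 'v measure" where
  "borel_of \<tau> = sigma (topspace \<tau>) {U. openin \<tau> U}"

definition full_support :: "'v topology \<Rightarrow> 'v measure \<Rightarrow> bool" where
  "full_support \<tau> \<mu> \<longleftrightarrow> (\<forall>U. openin \<tau> U \<and> U \<noteq> {} \<longrightarrow> emeasure \<mu> U > 0)"

definition invariant_measure :: "('v \<Rightarrow> 'v) \<Rightarrow> 'v measure \<Rightarrow> bool" where
  "invariant_measure T \<mu> \<longleftrightarrow>
     T \<in> measurable \<mu> \<mu> \<and>
     (\<forall>A\<in>sets \<mu>. emeasure \<mu> (T -` A \<inter> space \<mu>) = emeasure \<mu> A)"

definition exact_measure :: "('v \<Rightarrow> 'v) \<Rightarrow> 'v measure \<Rightarrow> bool" where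
  "exact_measure T \<mu> \<longleftrightarrow>
     (\<forall>A \<in> (\<Inter>n. (\<lambda>B. (T ^^ n) -` B \<inter> space \<mu>) ` sets \<mu>).
        emeasure \<mu> A = 0 \<or> emeasure \<mu> A = 1)"

end

theory Submission
  imports Defs
begin

text \<open>
  Let \<open>w\<close> be the weights of \<open>T\<close> and \<open>v\<^sub>n = 1 / (w\<^sub>1 \<cdots> w\<^sub>n)\<close> (indices start at \<open>0\<close>), so that \<open>T\<close> is the
  unweighted shift in the coordinates \<open>x\<^sub>n / v\<^sub>n\<close>. The measure is the law of the random series
  \<open>\<Sum>n. Y\<^sub>n v\<^sub>n e\<^sub>n\<close> with independent, identically distributed scalars \<open>Y\<^sub>n\<close>. Then \<open>T\<close> maps the series of
  \<open>(Y\<^sub>0, Y\<^sub>1, \<dots>)\<close> to the series of \<open>(Y\<^sub>1, Y\<^sub>2, \<dots>)\<close>, so that the law is invariant, and an event in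
  all \<open>T\<^sup>-\<^sup>n\<BB>\<close> corresponds up to null sets to a tail event of the \<open>Y\<^sub>n\<close>, so that
  Kolmogorov's zero-one law (\<open>iid_space_zero_one_law\<close>) gives exactness.

  The point is to choose the law of \<open>Y\<^sub>n\<close> such that its support is the whole scalar field, as full
  support of the measure requires, and such that the series converges almost surely. First, \<open>v\<close> itself
  belongs to the space (\<open>dense_periodic_points_imp_v_mem\<close>): density of the periodic points yields one
  with non-zero first coordinate, and \<open>v\<close> is assembled from it by coordinate projections, which
  preserve the space as the basis is unconditional, and powers of \<open>T\<close>. Next, let \<open>c\<^sub>0, c\<^sub>1, \<dots>\<close> be dense
  in the scalar field. Since each \<open>c\<^sub>j v\<close> has unconditionally small tails, there are thresholds \<open>N\<^sub>j\<close>
  such that the series \<open>\<Sum>n. c(\<omega>\<^sub>n) v\<^sub>n e\<^sub>n\<close> converges whenever \<open>N(\<omega>\<^sub>n) \<le> n\<close> for all large \<open>n\<close>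
  (\<open>countable_multiplier_tails_small\<close>). Finally take \<open>Y\<^sub>n = c(\<omega>\<^sub>n)\<close>, where the \<open>\<omega>\<^sub>n\<close> are independent
  with a law that charges every index and for which \<open>N\<close> has finite expectation: then
  \<open>\<Sum>n. P(N(\<omega>\<^sub>n) > n) < \<infinity>\<close>, and the Borel-Cantelli lemma gives almost sure convergence. Full support
  holds because the first coordinates can be prescribed arbitrarily closely while all later ones
  respect the thresholds, with positive probability (\<open>emeasure_cylinder_slow_pos\<close>).

  Measurability is elementary. The partial sums of the random series take countably many
  values, and both the series and \<open>T\<close> are pointwise limits of Borel maps.
\<close>

section \<open>Borel maps into metrizable spaces\<close>

lemma space_borel_of: "space (borel_of \<tau>) = topspace \<tau>"
  unfolding borel_of_def by (rule space_measure_of) (auto dest: openin_subset)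

lemma sets_borel_of: "sets (borel_of \<tau>) = sigma_sets (topspace \<tau>) {U. openin \<tau> U}"
  unfolding borel_of_def by (rule sets_measure_of) (auto dest: openin_subset)

lemma openin_sets_borel_of: "openin \<tau> U \<Longrightarrow> U \<in> sets (borel_of \<tau>)"
  unfolding sets_borel_of by auto

lemma measurable_borel_ofI:
  assumes "\<And>x. x \<in> space N \<Longrightarrow> f x \<in> topspace \<tau>"
    and "\<And>U. openin \<tau> U \<Longrightarrow> f -` U \<inter> space N \<in> sets N"
  shows "f \<in> measurable N (borel_of \<tau>)"
  by (rule measurable_sigma_sets[OF sets_borel_of]) (use assms in \<open>auto dest: openin_subset\<close>)

lemma continuous_map_measurable_borel_of:
  assumes "continuous_map \<tau> \<sigma> f"
  shows "f \<in> measurable (borel_of \<tau>) (borel_of \<sigma>)"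
proof (rule measurable_borel_ofI)
  show "f x \<in> topspace \<sigma>" if "x \<in> space (borel_of \<tau>)" for x
    using continuous_map_image_subset_topspace[OF assms] that by (auto simp: space_borel_of)
  show "f -` U \<inter> space (borel_of \<tau>) \<in> sets (borel_of \<tau>)" if "openin \<sigma> U" for U
  proof -
    have "openin \<tau> {x \<in> topspace \<tau>. f x \<in> U}"
      using assms that by (rule openin_continuous_map_preimage)
    moreover have "f -` U \<inter> space (borel_of \<tau>) = {x \<in> topspace \<tau>. f x \<in> U}"
      by (auto simp: space_borel_of)
    ultimately show ?thesis by (simp add: openin_sets_borel_of)
  qed
qed

text \<open>
  A pointwise limit of Borel maps into a metric space is a Borel map: \<open>g x \<in> U\<close> if and only if the
  \<open>f n x\<close> eventually stay in one of the closed sets \<open>C m\<close> of points at distance at least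
  \<open>1 / (m + 1)\<close> from the complement of \<open>U\<close>.
\<close>

lemma (in Metric_space) measurable_limit_borel_of_mtopology:
  assumes f: "\<And>n. f n \<in> measurable N (borel_of mtopology)"
    and lim: "\<And>x. x \<in> space N \<Longrightarrow> limitin mtopology (\<lambda>n. f n x) (g x) sequentially"
  shows "g \<in> measurable N (borel_of mtopology)"
proof (rule measurable_borel_ofI)
  have fM: "f n x \<in> M" if "x \<in> space N" for n x
    using measurable_space[OF f that, of n] by (simp add: space_borel_of)
  have gM: "g x \<in> M" if "x \<in> space N" for x
    using lim[OF that] by (simp add: limitin_metric)
  then show "\<And>x. x \<in> space N \<Longrightarrow> g x \<in> topspace mtopology" by simp
  show "g -` U \<inter> space N \<in> sets N" if U: "openin mtopology U" for U
  proof -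
    define C where "C m = {y \<in> M. \<forall>z \<in> M - U. inverse (real (Suc m)) \<le> d z y}" for m
    have C: "C m \<in> sets (borel_of mtopology)" for m
    proof -
      have "C m = M - (\<Union>z \<in> M - U. mball z (inverse (real (Suc m))))"
        by (force simp: C_def not_le[symmetric])
      moreover have "openin mtopology (\<Union>z \<in> M - U. mball z (inverse (real (Suc m))))"
        by auto
      then have "(\<Union>z \<in> M - U. mball z (inverse (real (Suc m)))) \<in> sets (borel_of mtopology)"
        by (rule openin_sets_borel_of)
      moreover have "M \<in> sets (borel_of mtopology)"
        by (rule openin_sets_borel_of) simp
      ultimately show ?thesis by simp
    qed
    have iff: "g x \<in> U \<longleftrightarrow> (\<exists>m K. \<forall>n\<ge>K. f n x \<in> C m)" if x: "x \<in> space N" for x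
    proof
      assume "g x \<in> U"
      then obtain r where r: "r > 0" "mball (g x) r \<subseteq> U"
        using U by (auto simp: openin_mtopology)
      obtain m where m: "inverse (real (Suc m)) < r / 2"
        using reals_Archimedean[of "r / 2"] r by auto
      obtain K where K: "\<And>n. n \<ge> K \<Longrightarrow> d (f n x) (g x) < r / 2"
        using lim[OF x] r unfolding limitin_metric eventually_sequentially
        by (meson half_gt_zero)
      have "f n x \<in> C m" if "n \<ge> K" for n
      proof -
        have "inverse (real (Suc m)) \<le> d z (f n x)" if z: "z \<in> M" "z \<notin> U" for z
        proof -
          have "r \<le> d (g x) z" using r(2) z gM[OF x] by (auto simp: subset_iff not_le[symmetric])
          also have "\<dots> \<le> d z (f n x) + d (f n x) (g x)"
            using triangle[of z "f n x" "g x"] z fM[OF x] gM[OF x] by (simp add: commute)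
          finally show ?thesis using K[OF \<open>n \<ge> K\<close>] m by linarith
        qed
        then show ?thesis using fM[OF x] by (auto simp: C_def)
      qed
      then show "\<exists>m K. \<forall>n\<ge>K. f n x \<in> C m" by blast
    next
      assume "\<exists>m K. \<forall>n\<ge>K. f n x \<in> C m"
      then obtain m K where K: "\<And>n. n \<ge> K \<Longrightarrow> f n x \<in> C m" by blast
      obtain L where L: "\<And>n. n \<ge> L \<Longrightarrow> d (f n x) (g x) < inverse (real (Suc m))"
        using lim[OF x] unfolding limitin_metric eventually_sequentially
        by (metis inverse_positive_iff_positive of_nat_0_less_iff zero_less_Suc)
      show "g x \<in> U"
      proof (rule ccontr)
        assume "g x \<notin> U"
        then have "inverse (real (Suc m)) \<le> d (g x) (f (max K L) x)"
          using K[of "max K L"] gM[OF x] by (auto simp: C_def)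
        then show False using L[of "max K L"] by (simp add: commute)
      qed
    qed
    have "g -` U \<inter> space N = (\<Union>m K. \<Inter>n\<in>{K..}. f n -` C m \<inter> space N)"
    proof (intro equalityI subsetI)
      fix x assume "x \<in> g -` U \<inter> space N"
      then show "x \<in> (\<Union>m K. \<Inter>n\<in>{K..}. f n -` C m \<inter> space N)" using iff[of x] by fastforce
    next
      fix x assume "x \<in> (\<Union>m K. \<Inter>n\<in>{K..}. f n -` C m \<inter> space N)"
      then obtain m K where K: "x \<in> f n -` C m \<inter> space N" if "n \<ge> K" for n by auto
      then show "x \<in> g -` U \<inter> space N" using iff[of x] by blast
    qed
    also have "\<dots> \<in> sets N"
    proof -
      define P where "P m n = f n -` C m \<inter> space N" for m n
      have "P m n \<in> sets N" for m n
        unfolding P_def using f C by (rule measurable_sets)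
      then have "(\<Union>m K. \<Inter>n\<in>{K..}. P m n) \<in> sets N"
        by (intro sets.countable_UN sets.countable_INT) auto
      then show ?thesis unfolding P_def .
    qed
    finally show ?thesis .
  qed
qed

section \<open>Independent, identically distributed coordinates\<close>

text \<open>The infinite product of a discrete distribution: independent coordinates, all with law \<open>p\<close>.\<close>

definition iid_space :: "'a pmf \<Rightarrow> (nat \<Rightarrow> 'a) measure" where
  "iid_space p = (\<Pi>\<^sub>M i\<in>UNIV. measure_pmf p)"

text \<open>The \<open>n\<close>-fold left shift, which forgets the first \<open>n\<close> coordinates.\<close>

definition left_shift :: "nat \<Rightarrow> (nat \<Rightarrow> 'a) \<Rightarrow> nat \<Rightarrow> 'a" where
  "left_shift n \<omega> = (\<lambda>i. \<omega> (i + n))"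

lemma space_iid_space [simp]: "space (iid_space p) = UNIV"
  by (simp add: iid_space_def space_PiM)

lemma prob_space_iid_space: "prob_space (iid_space p)"
  unfolding iid_space_def by (intro prob_space_PiM measure_pmf.prob_space_axioms)

lemma measurable_coordinate_iid_space:
  "(\<lambda>\<omega>. \<omega> n) \<in> measurable (iid_space p) (count_space UNIV)"
proof -
  have "(\<lambda>\<omega>. \<omega> n) \<in> measurable (iid_space p) (measure_pmf p)"
    unfolding iid_space_def by measurable
  then show ?thesis by simp
qed

lemma sets_coordinate_iid_space: "{\<omega>. \<omega> n \<in> S} \<in> sets (iid_space p)"
  using measurable_sets[OF measurable_coordinate_iid_space, of S n p] by (simp add: vimage_def)

lemma distr_coordinate_iid_space:
  "distr (iid_space p) (measure_pmf p) (\<lambda>\<omega>. \<omega> n) = measure_pmf p"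
  unfolding iid_space_def by (rule distr_PiM_component) (auto intro: measure_pmf.prob_space_axioms)

lemma emeasure_coordinate_iid_space:
  "emeasure (iid_space p) {\<omega>. \<omega> n \<in> S} = emeasure (measure_pmf p) S"
proof -
  have "emeasure (measure_pmf p) S = emeasure (distr (iid_space p) (measure_pmf p) (\<lambda>\<omega>. \<omega> n)) S"
    by (simp add: distr_coordinate_iid_space)
  also have "\<dots> = emeasure (iid_space p) {\<omega>. \<omega> n \<in> S}"
    using measurable_coordinate_iid_space[of n p] by (subst emeasure_distr) (auto simp: vimage_def)
  finally show ?thesis ..
qed

lemma distr_left_shift_iid_space:
  "distr (iid_space p) (iid_space p) (left_shift n) = iid_space p"
  using distr_PiM_reindex[of UNIV "\<lambda>_. measure_pmf p" "\<lambda>i. i + n" UNIV]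
  by (simp add: iid_space_def left_shift_def[abs_def] restrict_UNIV measure_pmf.prob_space_axioms)

lemma measurable_left_shift: "left_shift n \<in> measurable (iid_space p) (iid_space p)"
  unfolding iid_space_def left_shift_def[abs_def]
  by (rule measurable_PiM_single') (auto intro!: measurable_component_singleton)

lemma AE_left_shift:
  assumes "AE \<omega> in iid_space p. Q \<omega>"
  shows "AE \<omega> in iid_space p. \<forall>n. Q (left_shift n \<omega>)"
proof -
  have "AE \<omega> in iid_space p. Q (left_shift n \<omega>)" for n
  proof -
    have "AE \<omega> in distr (iid_space p) (iid_space p) (left_shift n). Q \<omega>"
      unfolding distr_left_shift_iid_space by (rule assms)
    then show ?thesis by (rule AE_distrD[OF measurable_left_shift])
  qed
  then show ?thesis by (simp add: AE_all_countable)
qed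

text \<open>
  Since lists over a countable type are countable, every function of finitely many coordinates,
  with values in any measurable space whatsoever, is measurable.
\<close>

lemma measurable_finitely_many_coordinates:
  fixes p :: "'a::countable pmf"
  shows "(\<lambda>\<omega>. map \<omega> [0..<n]) \<in> measurable (iid_space p) (count_space UNIV)"
proof (subst measurable_count_space_eq2_countable, intro conjI ballI)
  fix a :: "'a list"
  have "(\<lambda>\<omega>. map \<omega> [0..<n]) -` {a} \<inter> space (iid_space p) =
      (if length a = n then \<Inter>i\<in>{..<n}. {\<omega>. \<omega> i \<in> {a ! i}} else {})"
  proof -
    have "map \<omega> [0..<n] = a \<longleftrightarrow> length a = n \<and> (\<forall>i<n. \<omega> i = a ! i)" for \<omega>
      unfolding list_eq_iff_nth_eq by auto
    then show ?thesis by auto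
  qed
  also have "\<dots> \<in> sets (iid_space p)"
  proof (cases "n = 0")
    case True
    then show ?thesis using sets.top[of "iid_space p"] by auto
  next
    case False
    then show ?thesis
      by (auto intro!: sets.finite_INT intro: sets_coordinate_iid_space[where S = "{_}", simplified])
  qed
  finally show "(\<lambda>\<omega>. map \<omega> [0..<n]) -` {a} \<inter> space (iid_space p) \<in> sets (iid_space p)" .
qed auto

lemma indep_vars_coordinates:
  "prob_space.indep_vars (iid_space p) (\<lambda>_. measure_pmf p) (\<lambda>i \<omega>. \<omega> i) UNIV"
proof -
  interpret prob_space "iid_space p" by (rule prob_space_iid_space)
  show ?thesis
  proof (subst indep_vars_iff_distr_eq_PiM)
    show "random_variable (measure_pmf p) (\<lambda>\<omega>. \<omega> i)" for i
      using measurable_coordinate_iid_space[of i p] by simp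
    have "distr (iid_space p) (Pi\<^sub>M UNIV (\<lambda>_. measure_pmf p)) (\<lambda>x. x) = iid_space p"
      by (simp add: iid_space_def distr_id)
    then show "distr (iid_space p) (Pi\<^sub>M UNIV (\<lambda>_. measure_pmf p)) (\<lambda>x. \<lambda>i\<in>UNIV. x i) =
        (\<Pi>\<^sub>M i\<in>UNIV. distr (iid_space p) (measure_pmf p) (\<lambda>\<omega>. \<omega> i))"
      by (simp add: distr_coordinate_iid_space restrict_UNIV) (simp add: iid_space_def)
  qed simp
qed

text \<open>
  Kolmogorov's law for events that depend, up to null sets, on the coordinates from \<open>n\<close> on only, for
  every \<open>n\<close>. The upper limit of the events \<open>left_shift n -` D n\<close> is a genuine tail event and
  differs from \<open>A\<close> by a null set.
\<close>

lemma iid_space_zero_one_law: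
  assumes A: "A \<in> sets (iid_space p)"
    and D: "\<And>n. D n \<in> sets (iid_space p)"
    and AD: "\<And>n. AE \<omega> in iid_space p. \<omega> \<in> A \<longleftrightarrow> left_shift n \<omega> \<in> D n"
  shows "emeasure (iid_space p) A = 0 \<or> emeasure (iid_space p) A = 1"
proof -
  interpret prob_space "iid_space p" by (rule prob_space_iid_space)
  define G where "G i = sigma_sets UNIV {(\<lambda>\<omega>. \<omega> i) -` S | S. S \<in> (UNIV :: 'a set set)}" for i :: nat
  define C where "C n = left_shift n -` D n" for n
  define L where "L = (\<Inter>m. \<Union>n\<in>{m..}. C n)"
  have sC: "C n \<in> sets (iid_space p)" for n
    using measurable_sets[OF measurable_left_shift D, of n n] by (simp add: C_def)
  have tail: "C n \<in> sigma_sets UNIV (\<Union>i\<in>{n..}. G i)" for n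
  proof -
    let ?S = "sigma UNIV (\<Union>i\<in>{n..}. G i)"
    have s: "sets ?S = sigma_sets UNIV (\<Union>i\<in>{n..}. G i)"
      by (rule sets_measure_of) auto
    have "left_shift n \<in> measurable ?S (iid_space p)"
      unfolding iid_space_def
    proof (rule measurable_PiM_single)
      show "left_shift n \<in> space ?S \<rightarrow> (\<Pi>\<^sub>E i\<in>UNIV. space (measure_pmf p))" by auto
      show "{\<omega> \<in> space ?S. left_shift n \<omega> i \<in> S} \<in> sets ?S" for i and S :: "'a set"
      proof -
        have "{\<omega> \<in> space ?S. left_shift n \<omega> i \<in> S} = (\<lambda>\<omega>. \<omega> (i + n)) -` S"
          by (auto simp: left_shift_def)
        moreover have "(\<lambda>\<omega>. \<omega> (i + n)) -` S \<in> G (i + n)"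
          unfolding G_def by (rule sigma_sets.Basic) auto
        ultimately show ?thesis unfolding s by (intro sigma_sets.Basic) auto
      qed
    qed
    from measurable_sets[OF this D[of n]] show ?thesis
      by (simp add: s C_def space_measure_of_conv)
  qed
  have "prob L = 0 \<or> prob L = 1"
  proof (rule kolmogorov_0_1_law)
    show "sigma_algebra (space (iid_space p)) (G i)" for i
      unfolding G_def by (simp add: sigma_algebra_sigma_sets)
    show "indep_sets G UNIV"
      using indep_vars_coordinates[of p] by (simp add: indep_vars_def G_def[abs_def])
    show "L \<in> tail_events G"
      unfolding tail_events_def
    proof
      fix k
      interpret S: sigma_algebra UNIV "sigma_sets UNIV (\<Union>i\<in>{k..}. G i)"
        by (rule sigma_algebra_sigma_sets) auto
      have "C n \<in> sigma_sets UNIV (\<Union>i\<in>{k..}. G i)" if "n \<ge> k" for n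
      proof -
        have "sigma_sets UNIV (\<Union>i\<in>{n..}. G i) \<subseteq> sigma_sets UNIV (\<Union>i\<in>{k..}. G i)"
          using that by (intro sigma_sets_mono' UN_mono) auto
        then show ?thesis using tail by blast
      qed
      then have "(\<Inter>m. \<Union>n\<in>{m+k..}. C n) \<in> sigma_sets UNIV (\<Union>i\<in>{k..}. G i)"
        by (intro S.countable_INT S.countable_UN') auto
      moreover have "L = (\<Inter>m. \<Union>n\<in>{m+k..}. C n)"
        unfolding L_def
      proof (intro equalityI INT_greatest subsetI)
        fix x m assume "x \<in> (\<Inter>m. \<Union>n\<in>{m+k..}. C n)"
        then show "x \<in> (\<Union>n\<in>{m..}. C n)" by (fastforce dest: spec[of _ m])
      qed auto
      ultimately show "L \<in> sigma_sets (space (iid_space p)) (\<Union> (G ` {k..}))" by simp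
    qed
  qed
  moreover have "emeasure (iid_space p) A = emeasure (iid_space p) L"
  proof (rule emeasure_eq_AE)
    have "AE \<omega> in iid_space p. \<forall>n. \<omega> \<in> A \<longleftrightarrow> \<omega> \<in> C n"
      using AD by (simp add: AE_all_countable C_def)
    then show "AE \<omega> in iid_space p. \<omega> \<in> A \<longleftrightarrow> \<omega> \<in> L"
      by eventually_elim (auto simp: L_def)
    show "L \<in> sets (iid_space p)"
      unfolding L_def using sC by (intro sets.countable_INT sets.countable_UN') auto
  qed (rule A)
  ultimately show ?thesis by (auto simp: emeasure_eq_measure)
qed

section \<open>Unconditional bases of unit sequences\<close>

text \<open>The projection of a sequence onto the coordinates in \<open>S\<close>.\<close>

definition coord_proj :: "nat set \<Rightarrow> (nat \<Rightarrow> 'k::real_or_complex) \<Rightarrow> nat \<Rightarrow> 'k" where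
  "coord_proj S x = (\<lambda>n. if n \<in> S then x n else 0)"

lemma sum_fun_apply: "(\<Sum>i\<in>F. f i) n = (\<Sum>i\<in>F. (f i n :: 'k::real_or_complex))"
  by (induction F rule: infinite_finite_induct) auto

lemma coord_proj_eq_sum:
  "finite F \<Longrightarrow> coord_proj F x = (\<Sum>n\<in>F. seq_scale (x n) (unit_seq n))"
  by (rule ext) (simp add: coord_proj_def sum_fun_apply seq_scale_def unit_seq_def if_distrib cong: if_cong)

lemma coord_proj_coord_proj: "coord_proj F (coord_proj S x) = coord_proj (F \<inter> S) x"
  by (auto simp: coord_proj_def)

lemma coord_proj_diff_subset:
  "S \<subseteq> F \<Longrightarrow> coord_proj F x - coord_proj S x = coord_proj (F - S) x"
  by (auto simp: coord_proj_def fun_eq_iff)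

text \<open>
  A sequence F-space with the unit sequences as unconditional basis, together with a choice of a
  complete translation-invariant metric \<open>d\<close>.
\<close>

locale unit_basis_F_space = sequence_F_space \<tau>
  for \<tau> :: "(nat \<Rightarrow> 'k::real_or_complex) topology" +
  fixes d :: "(nat \<Rightarrow> 'k) \<Rightarrow> (nat \<Rightarrow> 'k) \<Rightarrow> real"
  assumes Metric_space_d: "Metric_space (topspace \<tau>) d"
    and mtopology_d: "Metric_space.mtopology (topspace \<tau>) d = \<tau>"
    and mcomplete_d: "Metric_space.mcomplete (topspace \<tau>) d"
    and translation_invariant:
      "\<And>x y z. x \<in> topspace \<tau> \<Longrightarrow> y \<in> topspace \<tau> \<Longrightarrow> z \<in> topspace \<tau> \<Longrightarrow> d (x + z) (y + z) = d x y"
    and unconditional_basis: "unit_seqs_unconditional_basis \<tau>"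
begin

abbreviation X :: "(nat \<Rightarrow> 'k) set" where "X \<equiv> topspace \<tau>"

sublocale ms: Metric_space X d
  by (rule Metric_space_d)

text \<open>
  The F-norm of the invariant metric: subadditive and symmetric, but in general not homogeneous.
\<close>

definition magnitude :: "(nat \<Rightarrow> 'k) \<Rightarrow> real" where
  "magnitude x = d x 0"

lemma zero_mem: "0 \<in> X" and add_mem: "x \<in> X \<Longrightarrow> y \<in> X \<Longrightarrow> x + y \<in> X"
  and scale_mem: "x \<in> X \<Longrightarrow> seq_scale c x \<in> X" and diff_mem: "x \<in> X \<Longrightarrow> y \<in> X \<Longrightarrow> x - y \<in> X"
  and sum_mem: "(\<And>i. i \<in> F \<Longrightarrow> f i \<in> X) \<Longrightarrow> sum f F \<in> X"
  using subspace_topspace by (auto intro: subspace_0 subspace_add subspace_scale subspace_diff subspace_sum)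

lemma unit_seq_mem: "unit_seq n \<in> X"
  using unconditional_basis by (auto simp: unit_seqs_unconditional_basis_def)

lemma coord_proj_finite_mem: "finite F \<Longrightarrow> coord_proj F x \<in> X"
  by (simp add: coord_proj_eq_sum sum_mem scale_mem unit_seq_mem)

lemma dist_eq_magnitude: "x \<in> X \<Longrightarrow> y \<in> X \<Longrightarrow> d x y = magnitude (x - y)"
  using translation_invariant[of "x - y" 0 y] by (simp add: magnitude_def diff_mem zero_mem)

lemma magnitude_zero: "magnitude 0 = 0"
  by (simp add: magnitude_def zero_mem)

lemma magnitude_minus_commute: "x \<in> X \<Longrightarrow> y \<in> X \<Longrightarrow> magnitude (x - y) = magnitude (y - x)"
  by (metis dist_eq_magnitude ms.commute)

lemma magnitude_add:
  assumes "x \<in> X" "y \<in> X"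
  shows "magnitude (x + y) \<le> magnitude x + magnitude y"
proof -
  have "d (x + y) 0 \<le> d (x + y) y + d y 0"
    using assms by (intro ms.triangle add_mem zero_mem)
  moreover have "d (x + y) y = d x 0"
    using translation_invariant[of x 0 y] assms zero_mem by simp
  ultimately show ?thesis by (simp add: magnitude_def)
qed

lemma magnitude_sum:
  "(\<And>i. i \<in> F \<Longrightarrow> f i \<in> X) \<Longrightarrow> magnitude (sum f F) \<le> (\<Sum>i\<in>F. magnitude (f i))"
proof (induction F rule: infinite_finite_induct)
  case (insert i F)
  then have "magnitude (f i + sum f F) \<le> magnitude (f i) + magnitude (sum f F)"
    by (intro magnitude_add sum_mem) auto
  then show ?case using insert by (simp del: plus_fun_apply)
qed (auto simp: magnitude_zero)

lemma limitin_iff_magnitude: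
  "limitin \<tau> f l sequentially \<longleftrightarrow>
    l \<in> X \<and> (\<forall>\<epsilon>>0. \<exists>N. \<forall>n\<ge>N. f n \<in> X \<and> magnitude (f n - l) < \<epsilon>)"
proof -
  have "limitin \<tau> f l sequentially \<longleftrightarrow> l \<in> X \<and> (\<forall>\<epsilon>>0. \<exists>N. \<forall>n\<ge>N. f n \<in> X \<and> d (f n) l < \<epsilon>)"
    using ms.limitin_metric[of f l sequentially]
    by (simp add: mtopology_d eventually_sequentially)
  moreover have "f n \<in> X \<and> d (f n) l < \<epsilon> \<longleftrightarrow> f n \<in> X \<and> magnitude (f n - l) < \<epsilon>" if "l \<in> X" for n \<epsilon>
    using that by (auto simp: dist_eq_magnitude)
  ultimately show ?thesis by auto
qed

lemma openin_iff_magnitude: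
  "openin \<tau> U \<longleftrightarrow> U \<subseteq> X \<and> (\<forall>x\<in>U. \<exists>\<epsilon>>0. \<forall>y\<in>X. magnitude (y - x) < \<epsilon> \<longrightarrow> y \<in> U)"
proof -
  have "openin \<tau> U \<longleftrightarrow> U \<subseteq> X \<and> (\<forall>x\<in>U. \<exists>\<epsilon>>0. ms.mball x \<epsilon> \<subseteq> U)"
    using ms.openin_mtopology[of U] by (auto simp: mtopology_d)
  moreover have "ms.mball x \<epsilon> \<subseteq> U \<longleftrightarrow> (\<forall>y\<in>X. magnitude (y - x) < \<epsilon> \<longrightarrow> y \<in> U)" if "x \<in> X" for x \<epsilon>
    using that by (auto simp: subset_iff dist_eq_magnitude magnitude_minus_commute)
  ultimately show ?thesis by (metis subset_iff)
qed

lemma openin_magnitude_ball: "openin \<tau> {x \<in> X. magnitude x < \<epsilon>}"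
proof -
  have "ms.mball 0 \<epsilon> = {x \<in> X. magnitude x < \<epsilon>}"
    by (auto simp: magnitude_def zero_mem ms.commute)
  then show ?thesis using ms.openin_mball[of 0 \<epsilon>] by (simp add: mtopology_d)
qed

lemma continuous_coordinate: "continuous_map \<tau> euclidean (\<lambda>x. x n)"
  using continuous_inclusion by (simp add: continuous_map_componentwise_UNIV)

lemma continuous_map_scale:
  assumes "continuous_map \<sigma> euclidean c" "continuous_map \<sigma> \<tau> f"
  shows "continuous_map \<sigma> \<tau> (\<lambda>x. seq_scale (c x) (f x))"
proof -
  have "continuous_map \<sigma> (prod_topology euclidean \<tau>) (\<lambda>x. (c x, f x))"
    using assms by (simp add: continuous_map_paired)
  from continuous_map_compose[OF this continuous_scale] show ?thesis by (simp add: o_def)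
qed

lemma continuous_map_sum_tau:
  assumes "\<And>i. i \<in> F \<Longrightarrow> continuous_map \<sigma> \<tau> (f i)"
  shows "continuous_map \<sigma> \<tau> (\<lambda>x. \<Sum>i\<in>F. f i x)"
  using assms
proof (induction F rule: infinite_finite_induct)
  case (insert i F)
  then have "continuous_map \<sigma> (prod_topology \<tau> \<tau>) (\<lambda>x. (f i x, \<Sum>i\<in>F. f i x))"
    by (simp add: continuous_map_paired)
  from continuous_map_compose[OF this continuous_add] insert(1,2) show ?case
    by (simp add: o_def del: plus_fun_apply)
qed (auto simp: zero_mem)

lemma magnitude_small_scale:
  assumes "x \<in> X" "\<epsilon> > 0"
  shows "\<exists>\<delta>>0. \<forall>c. norm c < \<delta> \<longrightarrow> magnitude (seq_scale c x) < \<epsilon>"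
proof -
  have "continuous_map euclidean \<tau> (\<lambda>c. seq_scale c x)"
    using assms by (intro continuous_map_scale) auto
  then have "openin euclidean {c \<in> topspace euclidean. seq_scale c x \<in> {x \<in> X. magnitude x < \<epsilon>}}"
    using openin_magnitude_ball by (rule openin_continuous_map_preimage)
  then have "open {c. seq_scale c x \<in> {x \<in> X. magnitude x < \<epsilon>}}" by simp
  moreover have "0 \<in> {c. seq_scale c x \<in> {x \<in> X. magnitude x < \<epsilon>}}"
    using assms by (simp add: zero_mem magnitude_zero)
  ultimately obtain \<delta> where "\<delta> > 0" "\<And>c. dist c 0 < \<delta> \<Longrightarrow> c \<in> {c. seq_scale c x \<in> {x \<in> X. magnitude x < \<epsilon>}}"
    unfolding open_dist by blast
  then show ?thesis by (intro exI[of _ \<delta>]) (auto simp: dist_norm)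
qed

lemma coord_proj_limitin:
  assumes "x \<in> X"
  shows "limitin \<tau> (\<lambda>N. coord_proj {..<N} x) x sequentially"
  using unconditional_basis assms
  by (simp add: unit_seqs_unconditional_basis_def converges_unconditionally_to_def coord_proj_eq_sum)

text \<open>
  Membership in the space is an unconditional Cauchy condition on the tails: by completeness the
  partial sums then converge, and their limit has the right coordinates because the
  inclusion into the product space is continuous.
\<close>

lemma mem_iff_tails_small:
  "x \<in> X \<longleftrightarrow> (\<forall>\<epsilon>>0. \<exists>K. \<forall>F. finite F \<and> F \<subseteq> {K..} \<longrightarrow> magnitude (coord_proj F x) < \<epsilon>)"
    (is "_ \<longleftrightarrow> ?small")
proof
  assume x: "x \<in> X"
  show ?small
  proof (intro allI impI)
    fix \<epsilon> :: real assume "\<epsilon> > 0"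
    then have "0 \<in> {x \<in> X. magnitude x < \<epsilon>}" by (simp add: zero_mem magnitude_zero)
    moreover have "converges_unconditionally_to \<tau> (\<lambda>n. seq_scale (x n) (unit_seq n)) x"
      using unconditional_basis x by (simp add: unit_seqs_unconditional_basis_def)
    ultimately obtain K where "\<forall>F. finite F \<and> F \<subseteq> {K..} \<longrightarrow>
        (\<Sum>n\<in>F. seq_scale (x n) (unit_seq n)) \<in> {x \<in> X. magnitude x < \<epsilon>}"
      unfolding converges_unconditionally_to_def using openin_magnitude_ball[of \<epsilon>] by presburger
    then show "\<exists>K. \<forall>F. finite F \<and> F \<subseteq> {K..} \<longrightarrow> magnitude (coord_proj F x) < \<epsilon>"
      by (auto simp: coord_proj_eq_sum)
  qed
next
  assume small: ?small
  have Cauchy: "ms.MCauchy (\<lambda>N. coord_proj {..<N} x)"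
    unfolding ms.MCauchy_def
  proof (intro conjI allI impI)
    show "range (\<lambda>N. coord_proj {..<N} x) \<subseteq> X" by (auto simp: coord_proj_finite_mem)
    fix \<epsilon> :: real assume "\<epsilon> > 0"
    then obtain K where K: "\<And>F. finite F \<Longrightarrow> F \<subseteq> {K..} \<Longrightarrow> magnitude (coord_proj F x) < \<epsilon>"
      using small by metis
    have le: "d (coord_proj {..<n'} x) (coord_proj {..<n} x) < \<epsilon>" if "K \<le> n" "n \<le> n'" for n n'
    proof -
      have "{..<n} \<subseteq> {..<n'}" "finite ({..<n'} - {..<n})" "{..<n'} - {..<n} \<subseteq> {K..}"
        using that by auto
      then show ?thesis
        using K by (simp add: dist_eq_magnitude coord_proj_finite_mem coord_proj_diff_subset)
    qed
    have "d (coord_proj {..<n} x) (coord_proj {..<n'} x) < \<epsilon>" if "K \<le> n" "K \<le> n'" for n n'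
      using le[of n n'] le[of n' n] that by (cases "n \<le> n'") (auto simp: ms.commute)
    then show "\<exists>N. \<forall>n n'. N \<le> n \<longrightarrow> N \<le> n' \<longrightarrow> d (coord_proj {..<n} x) (coord_proj {..<n'} x) < \<epsilon>"
      by blast
  qed
  then obtain y where y: "limitin \<tau> (\<lambda>N. coord_proj {..<N} x) y sequentially"
    using mcomplete_d by (auto simp: ms.mcomplete_def mtopology_d)
  have "y k = x k" for k
  proof -
    have "limitin euclidean ((\<lambda>z. z k) \<circ> (\<lambda>N. coord_proj {..<N} x)) (y k) sequentially"
      by (rule continuous_map_limit[OF continuous_coordinate y])
    then have "(\<lambda>N. coord_proj {..<N} x k) \<longlonglongrightarrow> y k" by (simp add: o_def)
    moreover have "(\<lambda>N. coord_proj {..<N} x k) \<longlonglongrightarrow> x k"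
    proof (rule tendsto_eventually)
      show "\<forall>\<^sub>F N in sequentially. coord_proj {..<N} x k = x k"
        using eventually_gt_at_top[of k] by eventually_elim (simp add: coord_proj_def)
    qed
    ultimately show ?thesis by (rule LIMSEQ_unique)
  qed
  then show "x \<in> X" using limitin_topspace[OF y] by (metis ext)
qed

lemma coord_proj_mem: "x \<in> X \<Longrightarrow> coord_proj S x \<in> X"
proof -
  assume x: "x \<in> X"
  have "\<exists>K. \<forall>F. finite F \<and> F \<subseteq> {K..} \<longrightarrow> magnitude (coord_proj F (coord_proj S x)) < \<epsilon>"
    if "\<epsilon> > 0" for \<epsilon>
  proof -
    obtain K where "\<And>F. finite F \<Longrightarrow> F \<subseteq> {K..} \<Longrightarrow> magnitude (coord_proj F x) < \<epsilon>"
      using x \<open>\<epsilon> > 0\<close> unfolding mem_iff_tails_small by metis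
    then show ?thesis by (intro exI[of _ K]) (auto simp: coord_proj_coord_proj le_infI1)
  qed
  then show ?thesis unfolding mem_iff_tails_small[of "coord_proj S x"] by simp
qed

text \<open>
  The key estimate. For countably many multipliers \<open>c j\<close> there are thresholds \<open>N j\<close> such that
  multiplying each coordinate \<open>n\<close> of \<open>v\<close> by some \<open>c j\<close> with \<open>N j \<le> n\<close> gives tails that are small
  uniformly in the choice of the multipliers \<open>\<omega>\<close>. A finite tail is grouped by the value \<open>j\<close> of
  \<open>\<omega>\<close>; the group of \<open>j\<close> is a finite tail of the element \<open>seq_scale (c j) v\<close> of the space, hence of
  magnitude below \<open>(1/2)^j\<close> by the choice of \<open>N j\<close>. No multiplier theorem is needed, which matters
  because the space need not be locally convex.
\<close>

lemma countable_multiplier_tails_small: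
  fixes c :: "nat \<Rightarrow> 'k"
  assumes v: "v \<in> X"
  shows "\<exists>N::nat \<Rightarrow> nat. \<forall>\<epsilon>>0. \<exists>K. \<forall>\<omega> F. finite F \<and> F \<subseteq> {K..} \<and> (\<forall>n\<in>F. N (\<omega> n) \<le> n) \<longrightarrow>
      magnitude (coord_proj F (\<lambda>n. c (\<omega> n) * v n)) < \<epsilon>"
proof -
  have tail: "\<exists>K. \<forall>F. finite F \<and> F \<subseteq> {K..} \<longrightarrow> magnitude (coord_proj F (seq_scale (c j) v)) < \<epsilon>"
    if "\<epsilon> > 0" for \<epsilon> j
    using scale_mem[OF v] that unfolding mem_iff_tails_small by metis
  have "\<forall>j. \<exists>K. \<forall>F. finite F \<and> F \<subseteq> {K..} \<longrightarrow> magnitude (coord_proj F (seq_scale (c j) v)) < (1/2)^j"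
    by (intro allI tail) simp
  then obtain N where N: "\<And>j F. finite F \<Longrightarrow> F \<subseteq> {N j..} \<Longrightarrow>
      magnitude (coord_proj F (seq_scale (c j) v)) < (1/2)^j"
    by metis
  have "\<exists>K. \<forall>\<omega> F. finite F \<and> F \<subseteq> {K..} \<and> (\<forall>n\<in>F. N (\<omega> n) \<le> n) \<longrightarrow>
      magnitude (coord_proj F (\<lambda>n. c (\<omega> n) * v n)) < \<epsilon>" if \<epsilon>: "\<epsilon> > 0" for \<epsilon> :: real
  proof -
    have "(\<lambda>J. \<Sum>k. (1/2::real)^(k + J)) \<longlonglongrightarrow> 0"
      by (rule suminf_exist_split2) (simp add: summable_geometric)
    then have "\<forall>\<^sub>F J in sequentially. (\<Sum>k. (1/2::real)^(k + J)) < \<epsilon> / 2"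
      using \<epsilon> by (intro order_tendstoD(2)) auto
    then obtain J where J: "(\<Sum>k. (1/2::real)^(k + J)) < \<epsilon> / 2"
      by (auto simp: eventually_sequentially)
    \<comment> \<open>The groups with \<open>j \<ge> J\<close> contribute less than \<open>\<epsilon>/2\<close> together; each of the other \<open>J\<close> groups is made
      smaller than \<open>\<epsilon> / (2 (J + 1))\<close> by starting late enough.\<close>
    define b where "b j = (if j < J then \<epsilon> / (2 * real (J + 1)) else (1/2)^j)" for j
    have b_nonneg: "0 \<le> b j" for j using \<epsilon> by (simp add: b_def)
    have "\<forall>j. \<exists>K. \<forall>F. finite F \<and> F \<subseteq> {K..} \<longrightarrow>
        magnitude (coord_proj F (seq_scale (c j) v)) < \<epsilon> / (2 * real (J + 1))"
      using \<epsilon> by (intro allI tail) simp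
    then obtain L where L: "\<And>j F. finite F \<Longrightarrow> F \<subseteq> {L j..} \<Longrightarrow>
        magnitude (coord_proj F (seq_scale (c j) v)) < \<epsilon> / (2 * real (J + 1))"
      by metis
    define K where "K = (\<Sum>j<J. L j)"
    have LK: "L j \<le> K" if "j < J" for j
      unfolding K_def using that by (intro member_le_sum) auto
    have "magnitude (coord_proj F (\<lambda>n. c (\<omega> n) * v n)) < \<epsilon>"
      if F: "finite F" "F \<subseteq> {K..}" "\<And>n. n \<in> F \<Longrightarrow> N (\<omega> n) \<le> n" for F \<omega>
    proof -
      define G where "G j = {n \<in> F. \<omega> n = j}" for j
      have G: "finite (G j)" "G j \<subseteq> {N j..}" "G j \<subseteq> {K..}" for j
        using F by (auto simp: G_def)
      have "coord_proj F (\<lambda>n. c (\<omega> n) * v n) =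
          (\<Sum>j\<in>\<omega> ` F. coord_proj (G j) (seq_scale (c j) v))"
      proof
        fix n
        have "(\<Sum>j\<in>\<omega> ` F. coord_proj (G j) (seq_scale (c j) v) n) =
            (\<Sum>j\<in>\<omega> ` F. if j = \<omega> n then coord_proj F (\<lambda>n. c (\<omega> n) * v n) n else 0)"
          by (intro sum.cong) (auto simp: G_def coord_proj_def seq_scale_def)
        also have "\<dots> = coord_proj F (\<lambda>n. c (\<omega> n) * v n) n"
          using F(1) by (auto simp: coord_proj_def)
        finally show "coord_proj F (\<lambda>n. c (\<omega> n) * v n) n =
            (\<Sum>j\<in>\<omega> ` F. coord_proj (G j) (seq_scale (c j) v)) n"
          by (simp add: sum_fun_apply)
      qed
      then have "magnitude (coord_proj F (\<lambda>n. c (\<omega> n) * v n)) =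
          magnitude (\<Sum>j\<in>\<omega> ` F. coord_proj (G j) (seq_scale (c j) v))" by (rule arg_cong)
      also have "\<dots> \<le> (\<Sum>j\<in>\<omega> ` F. magnitude (coord_proj (G j) (seq_scale (c j) v)))"
        using G by (intro magnitude_sum coord_proj_finite_mem)
      also have "\<dots> \<le> (\<Sum>j\<in>\<omega> ` F. b j)"
      proof (rule sum_mono)
        fix j
        have "G j \<subseteq> {L j..}" if "j < J" using G(3)[of j] LK[OF that] by auto
        then show "magnitude (coord_proj (G j) (seq_scale (c j) v)) \<le> b j"
          using N[of "G j" j] L[of "G j" j] G[of j] by (auto simp: b_def intro: less_imp_le)
      qed
      also have "\<dots> \<le> (\<Sum>j\<in>{..<J} \<union> {J..<J + Suc (Max (insert 0 (\<omega> ` F)))}. b j)"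
      proof (rule sum_mono2)
        have "\<omega> n \<le> Max (insert 0 (\<omega> ` F))" if "n \<in> F" for n
          using F(1) that by (intro Max_ge) auto
        then show "\<omega> ` F \<subseteq> {..<J} \<union> {J..<J + Suc (Max (insert 0 (\<omega> ` F)))}"
          by (fastforce simp: less_Suc_eq_le intro: trans_le_add2)
      qed (auto simp: b_nonneg)
      also have "\<dots> = (\<Sum>j<J. b j) + (\<Sum>j\<in>{J..<J + Suc (Max (insert 0 (\<omega> ` F)))}. b j)"
        by (intro sum.union_disjoint) auto
      also have "(\<Sum>j<J. b j) \<le> \<epsilon> / 2"
        using \<epsilon> by (simp add: b_def divide_simps algebra_simps)
      also have "(\<Sum>j\<in>{J..<J + Suc (Max (insert 0 (\<omega> ` F)))}. b j) =
          (\<Sum>k<Suc (Max (insert 0 (\<omega> ` F))). (1/2)^(k + J))"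
        unfolding b_def by (rule sum.reindex_bij_witness[of _ "\<lambda>k. k + J" "\<lambda>j. j - J"]) auto
      also have "\<dots> \<le> (\<Sum>k. (1/2::real)^(k + J))"
        by (intro sum_le_suminf) (auto simp: power_add intro: summable_mult2 summable_geometric)
      finally show ?thesis using J by simp
    qed
    then show ?thesis by (intro exI[of _ K]) simp
  qed
  then show ?thesis by (intro exI[of _ N]) simp
qed

end

section \<open>Chaotic weighted shifts\<close>

text \<open>
  \<open>T\<close> is only required to agree with the weighted shift on the space itself.
\<close>

locale backward_shift = unit_basis_F_space \<tau> d
  for \<tau> :: "(nat \<Rightarrow> 'k::real_or_complex) topology" and d +
  fixes w :: "nat \<Rightarrow> 'k" and T :: "(nat \<Rightarrow> 'k) \<Rightarrow> nat \<Rightarrow> 'k"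
  assumes weight_nonzero: "\<And>n. w n \<noteq> 0"
    and shift_mem: "\<And>x. x \<in> X \<Longrightarrow> weighted_backward_shift w x \<in> X"
    and T_eq: "\<And>x. x \<in> X \<Longrightarrow> T x = weighted_backward_shift w x"
begin

text \<open>
  The sequence \<open>v\<^sub>n = 1 / (w\<^sub>1 \<cdots> w\<^sub>n)\<close>, with \<open>v\<^sub>0 = 1\<close>. In the coordinates \<open>x\<^sub>n / v\<^sub>n\<close> the
  weighted shift becomes the unweighted one.
\<close>

definition v :: "nat \<Rightarrow> 'k" where
  "v n = (\<Prod>i<n. inverse (w (Suc i)))"

lemma v_nonzero: "v n \<noteq> 0"
  by (simp add: v_def weight_nonzero)

lemma weight_mult_v_Suc: "w (Suc n) * v (Suc n) = v n"
  by (simp add: v_def weight_nonzero)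

lemma T_funpow_mem: "x \<in> X \<Longrightarrow> (T ^^ m) x \<in> X"
  by (induction m) (auto simp: T_eq shift_mem)

text \<open>In the coordinates \<open>x\<^sub>n / v\<^sub>n\<close>, the power \<open>T\<^sup>m\<close> shifts by \<open>m\<close>; stated without division.\<close>

lemma T_funpow_apply:
  assumes "x \<in> X"
  shows "(T ^^ m) x n * v (n + m) = v n * x (n + m)"
  using assms
proof (induction m arbitrary: x)
  case (Suc m)
  have "(T ^^ Suc m) x n * (w (Suc (n + m)) * v (n + Suc m)) = (T ^^ m) (T x) n * v (n + m)"
    by (simp only: funpow_Suc_right o_apply add_Suc_right weight_mult_v_Suc)
  also have "\<dots> = v n * T x (n + m)"
    using Suc by (simp add: T_eq shift_mem)
  also have "\<dots> = v n * (w (Suc (n + m)) * x (n + Suc m))"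
    using Suc by (simp add: T_eq weighted_backward_shift_def)
  finally show ?case using weight_nonzero[of "Suc (n + m)"] by (simp add: ac_simps)
qed simp

text \<open>
  \<open>T x\<close> is the limit of its truncations to the first \<open>n\<close> coordinates, which depend continuously on
  \<open>x\<close>. Borel measurability therefore does not need the closed graph theorem.
\<close>

lemma T_measurable: "T \<in> measurable (borel_of \<tau>) (borel_of \<tau>)"
proof (rule ms.measurable_limit_borel_of_mtopology[unfolded mtopology_d])
  let ?f = "\<lambda>n x. coord_proj {..<n} (weighted_backward_shift w x)"
  show "?f n \<in> measurable (borel_of \<tau>) (borel_of \<tau>)" for n
  proof (rule continuous_map_measurable_borel_of)
    have "continuous_map \<tau> euclidean (\<lambda>x. w (Suc k) * x (Suc k))" for k
      using continuous_map_compose[OF continuous_coordinate, of euclidean "\<lambda>y. w (Suc k) * y" "Suc k"]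
      by (simp add: o_def continuous_on_mult_left)
    then have "continuous_map \<tau> \<tau> (\<lambda>x. \<Sum>k<n. seq_scale (w (Suc k) * x (Suc k)) (unit_seq k))"
      by (intro continuous_map_sum_tau continuous_map_scale) (auto simp: unit_seq_mem)
    then show "continuous_map \<tau> \<tau> (?f n)"
      by (simp add: coord_proj_eq_sum weighted_backward_shift_def)
  qed
  show "limitin \<tau> (\<lambda>n. ?f n x) (T x) sequentially" if "x \<in> space (borel_of \<tau>)" for x
    using that coord_proj_limitin[of "T x"] by (simp add: space_borel_of T_eq shift_mem)
qed

text \<open>
  If \<open>x\<close> has period \<open>N\<close>, then \<open>x\<^sub>n = x\<^sub>0 v\<^sub>n\<close> at all multiples \<open>n\<close> of \<open>N\<close>. The projection \<open>z\<close> of \<open>x\<close> to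
  these coordinates lies in the space, the images of \<open>z\<close> under \<open>T, \<dots>, T\<^sup>N\<close> are the projections of
  \<open>x\<^sub>0 v\<close> to the residue classes modulo \<open>N\<close>, and their sum is \<open>x\<^sub>0 v\<close>.
\<close>

lemma periodic_point_imp_v_mem:
  assumes x: "x \<in> X" and N: "N \<ge> 1" and per: "(T ^^ N) x = x" and x0: "x 0 \<noteq> 0"
  shows "v \<in> X"
proof -
  have step: "x (n + N) * v n = x n * v (n + N)" for n
    using T_funpow_apply[OF x, of N n] per by (simp add: mult.commute)
  have mult: "x (N * m) = x 0 * v (N * m)" for m
  proof (induction m)
    case 0
    show ?case by (simp add: v_def)
  next
    case (Suc m)
    have "x (N * m + N) * v (N * m) = x 0 * v (N * m + N) * v (N * m)"
      using step[of "N * m"] Suc by (simp add: ac_simps)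
    then show ?case by (simp add: v_nonzero add.commute)
  qed
  define z where "z = coord_proj {n. N dvd n} x"
  have z: "z \<in> X" unfolding z_def using x by (rule coord_proj_mem)
  have Tz: "(T ^^ (N - r)) z n = (if r = n mod N then x 0 * v n else 0)" if "r < N" for r n
  proof -
    have "N dvd n + (N - r) \<longleftrightarrow> (n + N) mod N = r mod N"
      using that by (subst mod_eq_dvd_iff_nat) auto
    then have dvd: "N dvd n + (N - r) \<longleftrightarrow> r = n mod N"
      using that by auto
    have "z (n + (N - r)) = (if r = n mod N then x 0 * v (n + (N - r)) else 0)"
      using mult by (auto simp: z_def coord_proj_def dvd[symmetric] elim!: dvdE)
    then have "(T ^^ (N - r)) z n * v (n + (N - r)) =
        (if r = n mod N then x 0 * v n else 0) * v (n + (N - r))"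
      using T_funpow_apply[OF z, of "N - r" n] by simp
    then show ?thesis using v_nonzero by simp
  qed
  have "(\<Sum>r<N. (T ^^ (N - r)) z) n = seq_scale (x 0) v n" for n
  proof -
    have "(\<Sum>r<N. (T ^^ (N - r)) z) n = (\<Sum>r<N. if r = n mod N then x 0 * v n else 0)"
      unfolding sum_fun_apply by (intro sum.cong) (auto simp: Tz)
    also have "\<dots> = seq_scale (x 0) v n"
      using N by (simp add: seq_scale_def)
    finally show ?thesis .
  qed
  then have "seq_scale (x 0) v = (\<Sum>r<N. (T ^^ (N - r)) z)" by (intro ext) simp
  then have "seq_scale (x 0) v \<in> X" using z by (simp add: sum_mem T_funpow_mem)
  then have "seq_scale (inverse (x 0)) (seq_scale (x 0) v) \<in> X" by (rule scale_mem)
  moreover have "seq_scale (inverse (x 0)) (seq_scale (x 0) v) = v"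
    using x0 by (simp add: seq_scale_def fun_eq_iff)
  ultimately show ?thesis by simp
qed

lemma dense_periodic_points_imp_v_mem:
  assumes "\<tau> closure_of (periodic_points_on \<tau> T) = X"
  shows "v \<in> X"
proof -
  have "openin \<tau> {x \<in> topspace \<tau>. x 0 \<in> - {0}}"
    using continuous_coordinate by (rule openin_continuous_map_preimage) auto
  moreover have "unit_seq 0 \<in> {x \<in> topspace \<tau>. x 0 \<in> - {0}}"
    using unit_seq_mem by (simp add: unit_seq_def)
  moreover have "unit_seq 0 \<in> \<tau> closure_of (periodic_points_on \<tau> T)"
    using assms unit_seq_mem by simp
  ultimately obtain x where "x \<in> periodic_points_on \<tau> T" "x \<in> {x \<in> topspace \<tau>. x 0 \<in> - {0}}"
    unfolding in_closure_of by meson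
  then show ?thesis
    using periodic_point_imp_v_mem by (auto simp: periodic_points_on_def)
qed

end

section \<open>The random series\<close>

text \<open>The witness is proportional to \<open>(1/2)^j / (1 + N j)\<close>.\<close>

lemma exists_positive_pmf_finite_expectation:
  fixes N :: "nat \<Rightarrow> nat"
  shows "\<exists>p :: nat pmf. (\<forall>j. pmf p j > 0) \<and> (\<integral>\<^sup>+j. of_nat (N j) \<partial>measure_pmf p) < \<infinity>"
proof -
  define f where "f j = (1/2)^j / (1 + real (N j))" for j
  have f_pos: "f j > 0" for j by (simp add: f_def add_pos_nonneg)
  have f_le: "f j \<le> (1/2)^j" for j by (simp add: f_def divide_simps)
  have f_le': "f j * real (N j) \<le> (1/2)^j" for j
    by (simp add: f_def divide_simps)
  have sf: "summable f"
    by (rule summable_comparison_test'[of "\<lambda>j. (1/2)^j" 0])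
      (use f_le f_pos in \<open>auto simp: less_imp_le summable_geometric\<close>)
  define Z where "Z = suminf f"
  have Z: "Z > 0" unfolding Z_def using sf f_pos by (rule suminf_pos)
  define p where "p = embed_pmf (\<lambda>j. f j / Z)"
  have pmf_p: "pmf p j = f j / Z" for j
    unfolding p_def
  proof (rule pmf_embed_pmf)
    show "0 \<le> f j / Z" for j using Z f_pos[of j] by simp
    then have "(\<integral>\<^sup>+ j. ennreal (f j / Z) \<partial>count_space UNIV) = ennreal (\<Sum>j. f j / Z)"
      by (simp add: nn_integral_count_space_nat suminf_ennreal2 summable_divide sf)
    also have "(\<Sum>j. f j / Z) = 1"
      using Z sf by (simp add: suminf_divide Z_def)
    finally show "(\<integral>\<^sup>+ j. ennreal (f j / Z) \<partial>count_space UNIV) = 1" by simp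
  qed
  have "(\<integral>\<^sup>+j. of_nat (N j) \<partial>measure_pmf p) = (\<Sum>j. ennreal (f j / Z * real (N j)))"
    using Z by (simp add: nn_integral_measure_pmf nn_integral_count_space_nat pmf_p ennreal_mult'[symmetric]
        ennreal_of_nat_eq_real_of_nat f_pos less_imp_le)
  also have "\<dots> = ennreal (\<Sum>j. f j / Z * real (N j))"
  proof (rule suminf_ennreal2)
    show "0 \<le> f j / Z * real (N j)" for j using Z f_pos[of j] by simp
    show "summable (\<lambda>j. f j / Z * real (N j))"
    proof (rule summable_comparison_test'[of "\<lambda>j. (1/2)^j / Z" 0])
      show "summable (\<lambda>j. (1/2::real)^j / Z)" by (simp add: summable_divide summable_geometric)
      show "norm (f j / Z * real (N j)) \<le> (1/2)^j / Z" for j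
        using f_le'[of j] Z f_pos[of j] by (simp add: abs_mult divide_right_mono)
    qed
  qed
  finally show ?thesis
    by (intro exI[of _ p]) (simp add: pmf_p Z f_pos)
qed

text \<open>
  A distribution \<open>p\<close> for which \<open>N\<close> has finite expectation. As
  \<open>\<Sum>n. P(N(\<omega>\<^sub>n) > n)\<close> is this expectation, independent coordinates \<open>\<omega>\<^sub>n\<close> with law \<open>p\<close> almost
  surely satisfy \<open>N(\<omega>\<^sub>n) \<le> n\<close> for all large \<open>n\<close>.
\<close>

locale iid_growth =
  fixes p :: "nat pmf" and N :: "nat \<Rightarrow> nat"
  assumes finite_expectation: "(\<integral>\<^sup>+j. of_nat (N j) \<partial>measure_pmf p) < \<infinity>"
begin

text \<open>The coordinates respect the thresholds \<open>N\<close> from some index on.\<close>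

definition slow :: "(nat \<Rightarrow> nat) \<Rightarrow> bool" where
  "slow \<omega> \<longleftrightarrow> (\<exists>K. \<forall>n\<ge>K. N (\<omega> n) \<le> n)"

lemma summable_excess: "summable (\<lambda>n. measure (measure_pmf p) {j. n < N j})"
proof (rule summable_suminf_not_top)
  have "(\<Sum>n. ennreal (measure (measure_pmf p) {j. n < N j})) = (\<integral>\<^sup>+j. of_nat (N j) \<partial>measure_pmf p)"
    by (subst nn_integral_nat_function) (auto simp: measure_pmf.emeasure_eq_measure)
  then show "(\<Sum>n. ennreal (measure (measure_pmf p) {j. n < N j})) \<noteq> \<top>"
    using finite_expectation by auto
qed simp

lemma sets_slow: "{\<omega>. slow \<omega>} \<in> sets (iid_space p)"
proof -
  define S where "S n = {\<omega>. \<omega> n \<in> {j. N j \<le> n}}" for n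
  have "S n \<in> sets (iid_space p)" for n
    unfolding S_def by (rule sets_coordinate_iid_space)
  then have "(\<Union>K. \<Inter>n\<in>{K..}. S n) \<in> sets (iid_space p)"
    by (intro sets.countable_UN sets.countable_INT) auto
  moreover have "{\<omega>. slow \<omega>} = (\<Union>K. \<Inter>n\<in>{K..}. S n)"
    by (auto simp: slow_def S_def)
  ultimately show ?thesis by simp
qed

lemma AE_slow: "AE \<omega> in iid_space p. slow \<omega>"
proof -
  have "AE \<omega> in iid_space p. eventually (\<lambda>n. \<omega> \<in> space (iid_space p) - {\<omega>. \<omega> n \<in> {j. n < N j}}) sequentially"
  proof (rule borel_cantelli_AE1)
    show "{\<omega>. \<omega> n \<in> {j. n < N j}} \<in> sets (iid_space p)" for n
      by (rule sets_coordinate_iid_space)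
    show "emeasure (iid_space p) {\<omega>. \<omega> n \<in> {j. n < N j}} < \<infinity>" for n
      unfolding emeasure_coordinate_iid_space by (simp add: measure_pmf.emeasure_eq_measure)
    show "summable (\<lambda>n. measure (iid_space p) {\<omega>. \<omega> n \<in> {j. n < N j}})"
      using summable_excess unfolding measure_def emeasure_coordinate_iid_space .
  qed
  then show ?thesis
    by eventually_elim (auto simp: slow_def eventually_sequentially not_less)
qed

text \<open>
  Prescribing the first \<open>K\<close> coordinates and requiring \<open>N(\<omega>\<^sub>n) \<le> n\<close> for all the others leaves an
  event of positive probability once \<open>K\<close> is so large that \<open>\<Sum>n\<ge>K. P(N(\<omega>\<^sub>n) > n) < 1/2\<close>.
\<close>

lemma emeasure_cylinder_slow_pos:
  assumes pos: "\<And>j. pmf p j > 0"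
  shows "\<exists>K0. \<forall>K\<ge>K0. \<forall>s. \<exists>E \<in> sets (iid_space p). emeasure (iid_space p) E > 0 \<and>
    (\<forall>\<omega>\<in>E. (\<forall>n<K. \<omega> n = s n) \<and> (\<forall>n\<ge>K. N (\<omega> n) \<le> n))"
proof -
  define q where "q n = measure (measure_pmf p) {j. n < N j}" for n
  have "(\<lambda>K. \<Sum>n. q (n + K)) \<longlonglongrightarrow> 0"
    by (rule suminf_exist_split2) (use summable_excess in \<open>simp add: q_def[abs_def]\<close>)
  then have "\<forall>\<^sub>F K in sequentially. (\<Sum>n. q (n + K)) < 1/2"
    by (intro order_tendstoD(2)) auto
  then obtain K0 where K0: "\<And>K. K \<ge> K0 \<Longrightarrow> (\<Sum>n. q (n + K)) < 1/2"
    by (auto simp: eventually_sequentially)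
  have "\<exists>E \<in> sets (iid_space p). emeasure (iid_space p) E > 0 \<and>
    (\<forall>\<omega>\<in>E. (\<forall>n<K. \<omega> n = s n) \<and> (\<forall>n\<ge>K. N (\<omega> n) \<le> n))" if K: "K \<ge> K0" for K s
  proof -
    define E where "E n = (if n < K then {s n} else {j. N j \<le> n})" for n
    interpret P: sequence_space "measure_pmf p"
      by unfold_locales
    interpret prob_space "iid_space p" by (rule prob_space_iid_space)
    have lim: "(\<lambda>n. \<Prod>i\<le>n. measure (measure_pmf p) (E i)) \<longlonglongrightarrow> measure (iid_space p) (Pi UNIV E)"
      using P.measure_PiM_countable[of E] by (simp add: iid_space_def)
    have "Pi UNIV E = (\<Inter>n\<in>UNIV. {\<omega>. \<omega> n \<in> E n})" by auto
    then have sets: "Pi UNIV E \<in> sets (iid_space p)"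
      using sets_coordinate_iid_space by (auto intro!: sets.countable_INT)
    define c where "c = (\<Prod>i<K. pmf p (s i))"
    have c: "c > 0" unfolding c_def using pos by (intro prod_pos) auto
    have ge: "c / 2 \<le> (\<Prod>i\<le>n. measure (measure_pmf p) (E i))" if "n \<ge> K" for n
    proof -
      have "(\<Prod>i\<le>n. measure (measure_pmf p) (E i)) =
          (\<Prod>i\<in>{..<K} \<union> {K..n}. measure (measure_pmf p) (E i))"
        using that by (intro prod.cong) auto
      also have "\<dots> = (\<Prod>i<K. measure (measure_pmf p) (E i)) * (\<Prod>i\<in>{K..n}. measure (measure_pmf p) (E i))"
        by (intro prod.union_disjoint) auto
      also have "(\<Prod>i<K. measure (measure_pmf p) (E i)) = c"
        by (simp add: c_def E_def measure_pmf_single)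
      also have "(\<Prod>i\<in>{K..n}. measure (measure_pmf p) (E i)) = (\<Prod>i\<in>{K..n}. 1 - q i)"
      proof (rule prod.cong)
        fix i assume "i \<in> {K..n}"
        then have "E i = UNIV - {j. i < N j}" by (auto simp: E_def)
        then show "measure (measure_pmf p) (E i) = 1 - q i"
          using measure_pmf.prob_compl[of "{j. i < N j}" p] by (simp add: q_def)
      qed simp
      also have "c * \<dots> \<ge> c * (1/2)"
      proof (rule mult_left_mono)
        have "(\<Sum>i\<in>{K..n}. q i) = (\<Sum>i<Suc n - K. q (i + K))"
          using that by (intro sum.reindex_bij_witness[of _ "\<lambda>i. i + K" "\<lambda>i. i - K"]) auto
        also have "\<dots> \<le> (\<Sum>i. q (i + K))"
          using summable_excess by (intro sum_le_suminf) 
            (auto simp: q_def summable_iff_shift[of "\<lambda>n. measure (measure_pmf p) {j. n < N j}"])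
        also have "\<dots> < 1/2" using K by (rule K0)
        finally show "1/2 \<le> (\<Prod>i\<in>{K..n}. 1 - q i)"
          using Weierstrass_prod_ineq[of "{K..n}" q] by (simp add: q_def)
      qed (use c in simp)
      finally show ?thesis by simp
    qed
    have "c / 2 \<le> measure (iid_space p) (Pi UNIV E)"
      by (rule tendsto_lowerbound[OF lim]) (use ge in \<open>auto simp: eventually_sequentially\<close>)
    then have "emeasure (iid_space p) (Pi UNIV E) > 0"
      using c by (simp add: emeasure_eq_measure)
    moreover have "(\<forall>n<K. \<omega> n = s n) \<and> (\<forall>n\<ge>K. N (\<omega> n) \<le> n)" if "\<omega> \<in> Pi UNIV E" for \<omega>
    proof -
      have "\<omega> n \<in> E n" for n using that by auto
      then show ?thesis unfolding E_def by (metis leD mem_Collect_eq singletonD)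
    qed
    ultimately show ?thesis using sets by blast
  qed
  then show ?thesis by blast
qed

end

text \<open>
  The data of the construction: dense multipliers \<open>c j\<close>, thresholds \<open>N j\<close> with the uniform tail
  estimate, and a fully supported law \<open>p\<close> of the indices for which \<open>N\<close> has finite expectation.
\<close>

locale random_series = backward_shift \<tau> d w T + iid_growth p N
  for \<tau> :: "(nat \<Rightarrow> 'k::real_or_complex) topology" and d w T p N +
  fixes c :: "nat \<Rightarrow> 'k"
  assumes v_mem: "v \<in> X"
    and positive: "\<And>j. pmf p j > 0"
    and dense: "\<And>U :: 'k set. open U \<Longrightarrow> U \<noteq> {} \<Longrightarrow> \<exists>j. c j \<in> U"
    and tails_small: "\<And>\<epsilon>. \<epsilon> > 0 \<Longrightarrow> \<exists>K. \<forall>\<omega> F. finite F \<and> F \<subseteq> {K..} \<and> (\<forall>n\<in>F. N (\<omega> n) \<le> n) \<longrightarrow>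
      magnitude (coord_proj F (\<lambda>n. c (\<omega> n) * v n)) < \<epsilon>"
begin

text \<open>
  The random element \<open>\<Sum>n. c(\<omega>\<^sub>n) v\<^sub>n e\<^sub>n\<close> of the space. On the null set of \<open>\<omega>\<close> that do not respect
  the thresholds, where the sequence may lie outside the space, it is set to \<open>0\<close>.
\<close>

definition series :: "(nat \<Rightarrow> nat) \<Rightarrow> nat \<Rightarrow> 'k" where
  "series \<omega> = (if slow \<omega> then (\<lambda>n. c (\<omega> n) * v n) else 0)"

text \<open>The distribution of the random series on the space.\<close>

definition law :: "(nat \<Rightarrow> 'k) measure" where
  "law = distr (iid_space p) (borel_of \<tau>) series"

lemma series_mem: "series \<omega> \<in> X"
proof (cases "slow \<omega>")
  case True
  then obtain L where L: "\<And>n. n \<ge> L \<Longrightarrow> N (\<omega> n) \<le> n" by (auto simp: slow_def)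
  have "(\<lambda>n. c (\<omega> n) * v n) \<in> X"
    unfolding mem_iff_tails_small
  proof (intro allI impI)
    fix \<epsilon> :: real assume "\<epsilon> > 0"
    from tails_small[OF this] obtain K where
      K: "\<forall>\<omega> F. finite F \<and> F \<subseteq> {K..} \<and> (\<forall>n\<in>F. N (\<omega> n) \<le> n) \<longrightarrow>
        magnitude (coord_proj F (\<lambda>n. c (\<omega> n) * v n)) < \<epsilon>" ..
    have "magnitude (coord_proj F (\<lambda>n. c (\<omega> n) * v n)) < \<epsilon>" if "finite F" "F \<subseteq> {max K L..}" for F
    proof -
      have "F \<subseteq> {K..}" "\<forall>n\<in>F. N (\<omega> n) \<le> n" using that L by auto
      then show ?thesis using K that(1) by simp
    qed
    then show "\<exists>K. \<forall>F. finite F \<and> F \<subseteq> {K..} \<longrightarrow> magnitude (coord_proj F (\<lambda>n. c (\<omega> n) * v n)) < \<epsilon>"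
      by (intro exI[of _ "max K L"]) simp
  qed
  then show ?thesis using True by (simp add: series_def)
qed (simp add: series_def zero_mem)

lemma series_measurable: "series \<in> measurable (iid_space p) (borel_of \<tau>)"
proof (rule ms.measurable_limit_borel_of_mtopology[unfolded mtopology_d])
  let ?g = "\<lambda>n (l :: nat list). coord_proj {..<n} (\<lambda>k. c (l ! k) * v k)"
  let ?f = "\<lambda>n \<omega>. if slow \<omega> then ?g n (map \<omega> [0..<n]) else 0"
  show "?f n \<in> measurable (iid_space p) (borel_of \<tau>)" for n
  proof (rule measurable_If)
    have "?g n \<in> measurable (count_space UNIV) (borel_of \<tau>)"
      by (simp add: space_borel_of coord_proj_finite_mem)
    with measurable_finitely_many_coordinates
    show "(\<lambda>\<omega>. ?g n (map \<omega> [0..<n])) \<in> measurable (iid_space p) (borel_of \<tau>)"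
      by (rule measurable_compose)
    show "(\<lambda>\<omega>. 0) \<in> measurable (iid_space p) (borel_of \<tau>)"
      by (rule measurable_const) (simp add: space_borel_of zero_mem)
    show "{x \<in> space (iid_space p). slow x} \<in> sets (iid_space p)"
      using sets_slow by simp
  qed
  show "limitin \<tau> (\<lambda>n. ?f n \<omega>) (series \<omega>) sequentially" for \<omega>
  proof -
    have "?f n \<omega> = coord_proj {..<n} (series \<omega>)" for n
      by (auto simp: series_def coord_proj_def)
    then show ?thesis using coord_proj_limitin[OF series_mem] by simp
  qed
qed

text \<open>
  Almost surely, \<open>T\<close> acts on the random series as the left shift acts on \<open>\<omega>\<close>.
\<close>

lemma AE_T_funpow_series:
  "AE \<omega> in iid_space p. \<forall>n. (T ^^ n) (series \<omega>) = series (left_shift n \<omega>)"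
  using AE_left_shift[OF AE_slow]
proof eventually_elim
  case (elim \<omega>)
  have "slow \<omega>" using elim[rule_format, of 0] by (simp add: left_shift_def)
  show ?case
  proof (intro allI ext)
    fix n k
    have "(T ^^ n) (series \<omega>) k * v (k + n) = series (left_shift n \<omega>) k * v (k + n)"
      using T_funpow_apply[OF series_mem, of n \<omega> k] \<open>slow \<omega>\<close> elim[rule_format, of n]
      by (simp add: series_def left_shift_def mult.commute)
    then show "(T ^^ n) (series \<omega>) k = series (left_shift n \<omega>) k"
      by (simp add: v_nonzero)
  qed
qed

lemma sets_law: "sets law = sets (borel_of \<tau>)"
  by (simp add: law_def)

lemma space_law: "space law = X"
  by (simp add: law_def space_borel_of)

lemma emeasure_law:
  "A \<in> sets (borel_of \<tau>) \<Longrightarrow> emeasure law A = emeasure (iid_space p) (series -` A)"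
  using series_measurable by (simp add: law_def emeasure_distr)

lemma sets_series_vimage: "A \<in> sets (borel_of \<tau>) \<Longrightarrow> series -` A \<in> sets (iid_space p)"
  using measurable_sets[OF series_measurable] by simp

lemma prob_space_law: "prob_space law"
  unfolding law_def by (rule prob_space.prob_space_distr[OF prob_space_iid_space series_measurable])

lemma invariant_law: "invariant_measure T law"
  unfolding invariant_measure_def
proof (intro conjI ballI)
  show "T \<in> measurable law law"
    using T_measurable by (simp add: measurable_cong_sets[OF sets_law sets_law])
  fix A assume "A \<in> sets law"
  then have A: "A \<in> sets (borel_of \<tau>)" by (simp add: sets_law)
  have TA: "T -` A \<inter> X \<in> sets (borel_of \<tau>)"
    using measurable_sets[OF T_measurable A] by (simp add: space_borel_of)
  have "emeasure law (T -` A \<inter> space law) = emeasure (iid_space p) (series -` (T -` A \<inter> X))"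
    using TA by (simp add: emeasure_law space_law)
  also have "\<dots> = emeasure (iid_space p) (left_shift 1 -` (series -` A))"
  proof (rule emeasure_eq_AE)
    show "AE \<omega> in iid_space p. \<omega> \<in> series -` (T -` A \<inter> X) \<longleftrightarrow> \<omega> \<in> left_shift 1 -` (series -` A)"
      using AE_T_funpow_series
    proof eventually_elim
      case (elim \<omega>)
      then have "T (series \<omega>) = series (left_shift 1 \<omega>)" by (auto dest: spec[of _ 1])
      then show ?case by (simp add: series_mem)
    qed
    show "left_shift 1 -` series -` A \<in> sets (iid_space p)"
      using measurable_sets[OF measurable_left_shift sets_series_vimage[OF A], of 1] by simp
  qed (rule sets_series_vimage[OF TA])
  also have "\<dots> = emeasure (distr (iid_space p) (iid_space p) (left_shift 1)) (series -` A)"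
    using measurable_left_shift[of 1 p] sets_series_vimage[OF A] by (simp add: emeasure_distr)
  also have "\<dots> = emeasure law A"
    using A by (simp add: distr_left_shift_iid_space emeasure_law)
  finally show "emeasure law (T -` A \<inter> space law) = emeasure law A" .
qed

lemma exact_law: "exact_measure T law"
  unfolding exact_measure_def
proof
  fix A assume A: "A \<in> (\<Inter>n. (\<lambda>B. (T ^^ n) -` B \<inter> space law) ` sets law)"
  then have "\<forall>n. \<exists>B. B \<in> sets law \<and> A = (T ^^ n) -` B \<inter> X"
    unfolding space_law by blast
  then obtain B where B: "\<And>n. B n \<in> sets (borel_of \<tau>)" and AB: "\<And>n. A = (T ^^ n) -` B n \<inter> X"
    unfolding sets_law by metis
  have "A = B 0 \<inter> X" using AB[of 0] by simp
  then have sA: "A \<in> sets (borel_of \<tau>)"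
    using B[of 0] sets.top[of "borel_of \<tau>"] by (simp add: space_borel_of sets.Int)
  have "emeasure (iid_space p) (series -` A) = 0 \<or> emeasure (iid_space p) (series -` A) = 1"
  proof (rule iid_space_zero_one_law[where D = "\<lambda>n. series -` B n"])
    show "series -` B n \<in> sets (iid_space p)" for n using B by (rule sets_series_vimage)
    show "AE \<omega> in iid_space p. \<omega> \<in> series -` A \<longleftrightarrow> left_shift n \<omega> \<in> series -` B n" for n
      using AE_T_funpow_series
    proof eventually_elim
      case (elim \<omega>)
      show ?case using elim by (subst AB[of n]) (simp add: series_mem)
    qed
  qed (rule sets_series_vimage[OF sA])
  then show "emeasure law A = 0 \<or> emeasure law A = 1"
    using sA by (simp add: emeasure_law)
qed

text \<open>
  Given \<open>x\<close> in an open set, the first \<open>K\<close> coordinates are prescribed such that \<open>c(s\<^sub>n) v\<^sub>n\<close> is close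
  to \<open>x\<^sub>n\<close>, and all others are only required to respect the thresholds. This event has positive
  probability, and on it the series is close to \<open>x\<close>: the difference is split into a truncation error
  of the series, a finite tail of the series, the error on the first \<open>K\<close> coordinates, and a
  truncation error of \<open>x\<close>.
\<close>

lemma full_support_law: "full_support \<tau> law"
  unfolding full_support_def
proof (intro allI impI)
  fix U assume U: "openin \<tau> U \<and> U \<noteq> {}"
  then obtain x where x: "x \<in> U" by blast
  then have xX: "x \<in> X" using U openin_subset by blast
  have "\<exists>\<epsilon>>0. \<forall>y\<in>X. magnitude (y - x) < \<epsilon> \<longrightarrow> y \<in> U"
    using U x by (simp add: openin_iff_magnitude)
  then obtain \<epsilon> where \<epsilon>: "\<epsilon> > 0" and ball: "\<And>y. y \<in> X \<Longrightarrow> magnitude (y - x) < \<epsilon> \<Longrightarrow> y \<in> U"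
    by auto
  have "\<epsilon> / 4 > 0" using \<epsilon> by simp
  from tails_small[OF this] obtain K1 where
    K1: "\<And>\<omega> F. finite F \<and> F \<subseteq> {K1..} \<and> (\<forall>n\<in>F. N (\<omega> n) \<le> n) \<Longrightarrow>
      magnitude (coord_proj F (\<lambda>n. c (\<omega> n) * v n)) < \<epsilon> / 4" by metis
  obtain K2 where K2: "\<And>n. n \<ge> K2 \<Longrightarrow> magnitude (coord_proj {..<n} x - x) < \<epsilon> / 4"
    using coord_proj_limitin[OF xX] \<open>\<epsilon> / 4 > 0\<close> unfolding limitin_iff_magnitude by metis
  from emeasure_cylinder_slow_pos[OF positive] obtain K0 where
    K0: "\<forall>K\<ge>K0. \<forall>s. \<exists>E \<in> sets (iid_space p). emeasure (iid_space p) E > 0 \<and>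
      (\<forall>\<omega>\<in>E. (\<forall>n<K. \<omega> n = s n) \<and> (\<forall>n\<ge>K. N (\<omega> n) \<le> n))" ..
  define K where "K = max K0 (max K1 K2)"
  have "\<exists>j. magnitude (seq_scale (c j * v n - x n) (unit_seq n)) < \<epsilon> / (4 * real (Suc K))" for n
  proof -
    have "\<epsilon> / (4 * real (Suc K)) > 0" using \<epsilon> by simp
    from magnitude_small_scale[OF unit_seq_mem this] obtain \<delta> where \<delta>: "\<delta> > 0"
      "\<And>a. norm a < \<delta> \<Longrightarrow> magnitude (seq_scale a (unit_seq n)) < \<epsilon> / (4 * real (Suc K))" by metis
    have "\<exists>j. c j \<in> ball (x n / v n) (\<delta> / norm (v n))"
      using \<delta>(1) v_nonzero[of n] by (intro dense) (auto simp: not_le)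
    then obtain j where j: "norm (c j - x n / v n) < \<delta> / norm (v n)"
      by (auto simp: dist_norm norm_minus_commute)
    have "c j * v n - x n = (c j - x n / v n) * v n"
      using v_nonzero by (simp add: field_simps)
    then have "norm (c j * v n - x n) < \<delta>"
      using j v_nonzero[of n] by (simp add: norm_mult pos_less_divide_eq)
    then show ?thesis using \<delta>(2) by blast
  qed
  then obtain s where s: "\<And>n. magnitude (seq_scale (c (s n) * v n - x n) (unit_seq n)) < \<epsilon> / (4 * real (Suc K))"
    by metis
  obtain E where E: "E \<in> sets (iid_space p)" "emeasure (iid_space p) E > 0"
    and Es: "\<And>\<omega> n. \<omega> \<in> E \<Longrightarrow> n < K \<Longrightarrow> \<omega> n = s n" and EN: "\<And>\<omega> n. \<omega> \<in> E \<Longrightarrow> n \<ge> K \<Longrightarrow> N (\<omega> n) \<le> n"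
    using K0[rule_format, of K s] unfolding K_def by (meson max.cobounded1)
  have "series \<omega> \<in> U" if \<omega>: "\<omega> \<in> E" for \<omega>
  proof -
    let ?y = "series \<omega>"
    have y: "?y = (\<lambda>n. c (\<omega> n) * v n)"
      using EN[OF \<omega>] by (auto simp: series_def slow_def)
    obtain L where L: "\<And>n. n \<ge> L \<Longrightarrow> magnitude (coord_proj {..<n} ?y - ?y) < \<epsilon> / 4"
      using coord_proj_limitin[OF series_mem] \<open>\<epsilon> / 4 > 0\<close> unfolding limitin_iff_magnitude by metis
    define M where "M = max K L"
    have KM: "K \<le> M" by (simp add: M_def)
    let ?a = "?y - coord_proj {..<M} ?y" and ?b = "coord_proj {K..<M} ?y"
      and ?h = "\<Sum>n<K. seq_scale (c (s n) * v n - x n) (unit_seq n)" and ?e = "coord_proj {..<K} x - x"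
    have mem: "?a \<in> X" "?b \<in> X" "?h \<in> X" "?e \<in> X"
      using series_mem xX
      by (auto intro!: diff_mem coord_proj_finite_mem sum_mem scale_mem unit_seq_mem)
    have "?h = coord_proj {..<K} (\<lambda>n. c (s n) * v n - x n)"
      by (simp add: coord_proj_eq_sum)
    then have h: "?h n = (if n < K then ?y n - x n else 0)" for n
      using Es[OF \<omega>] by (simp add: coord_proj_def y)
    have "?y - x = ?a + (?b + (?h + ?e))"
    proof
      fix n
      show "(?y - x) n = (?a + (?b + (?h + ?e))) n"
        using KM h[of n] by (simp add: coord_proj_def)
    qed
    then have "magnitude (?y - x) \<le> magnitude ?a + (magnitude ?b + (magnitude ?h + magnitude ?e))"
      using mem magnitude_add add_mem by (smt (verit, best))
    moreover have "magnitude ?a < \<epsilon> / 4"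
      using L[of M] magnitude_minus_commute[OF series_mem coord_proj_finite_mem[of "{..<M}" ?y]]
      by (simp add: M_def)
    moreover have "magnitude ?b < \<epsilon> / 4"
      unfolding y using EN[OF \<omega>] by (intro K1) (auto simp: K_def)
    moreover have "magnitude ?h \<le> \<epsilon> / 4"
    proof -
      have "magnitude ?h \<le> (\<Sum>n<K. magnitude (seq_scale (c (s n) * v n - x n) (unit_seq n)))"
        by (intro magnitude_sum scale_mem unit_seq_mem)
      also have "\<dots> \<le> (\<Sum>n<K. \<epsilon> / (4 * real (Suc K)))"
        using s by (intro sum_mono less_imp_le)
      also have "\<dots> \<le> \<epsilon> / 4"
        using \<epsilon> by (simp add: divide_simps)
      finally show ?thesis .
    qed
    moreover have "magnitude ?e < \<epsilon> / 4"
      by (rule K2) (simp add: K_def)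
    ultimately have "magnitude (?y - x) < \<epsilon>" by linarith
    then show ?thesis by (rule ball[OF series_mem])
  qed
  then have "E \<subseteq> series -` U" by auto
  have sU: "U \<in> sets (borel_of \<tau>)" using U by (simp add: openin_sets_borel_of)
  have "0 < emeasure (iid_space p) E" by (rule E)
  also have "\<dots> \<le> emeasure (iid_space p) (series -` U)"
    using \<open>E \<subseteq> series -` U\<close> sets_series_vimage[OF sU] by (rule emeasure_mono)
  also have "\<dots> = emeasure law U" using sU by (simp add: emeasure_law)
  finally show "emeasure law U > 0" .
qed

end

theorem mainTheorem2:
  fixes \<tau> :: "(nat \<Rightarrow> 'k::real_or_complex) topology"
    and T :: "(nat \<Rightarrow> 'k) \<Rightarrow> (nat \<Rightarrow> 'k)"
  assumes "sequence_F_space \<tau>"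
    and "unit_seqs_unconditional_basis \<tau>"
    and "is_weighted_backward_shift_on \<tau> T"
    and "chaotic_on \<tau> T"
  shows "\<exists>\<mu> :: (nat \<Rightarrow> 'k) measure.
           sets \<mu> = sets (borel_of \<tau>) \<and> prob_space \<mu> \<and>
           invariant_measure T \<mu> \<and> exact_measure T \<mu> \<and> full_support \<tau> \<mu>"
proof -
  interpret sequence_F_space \<tau> by (rule assms(1))
  obtain d where d: "Metric_space (topspace \<tau>) d" "Metric_space.mtopology (topspace \<tau>) d = \<tau>"
      "Metric_space.mcomplete (topspace \<tau>) d"
      "\<forall>x\<in>topspace \<tau>. \<forall>y\<in>topspace \<tau>. \<forall>z\<in>topspace \<tau>. d (x + z) (y + z) = d x y"
    using complete_invariant_metric by metis
  obtain w where w: "\<forall>n. w n \<noteq> 0" "weighted_backward_shift w ` topspace \<tau> \<subseteq> topspace \<tau>"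
      "\<forall>x\<in>topspace \<tau>. T x = weighted_backward_shift w x"
    using assms(3) unfolding is_weighted_backward_shift_on_def by metis
  interpret backward_shift \<tau> d w T
    by (intro backward_shift.intro unit_basis_F_space.intro unit_basis_F_space_axioms.intro
        backward_shift_axioms.intro) (use d w assms(1,2) in auto)
  have v_mem: "v \<in> X"
    using assms(4) by (intro dense_periodic_points_imp_v_mem) (simp add: chaotic_on_def)
  obtain D :: "'k set" where D: "countable D" "\<And>U. open U \<Longrightarrow> U \<noteq> {} \<Longrightarrow> \<exists>y\<in>D. y \<in> U"
    using countable_dense_exists[where 'a = 'k] by blast
  have dense: "\<exists>j. from_nat_into D j \<in> U" if "open U" "U \<noteq> {}" for U
    using D(2)[OF that] from_nat_into_surj[OF D(1)] by metis
  obtain N where N: "\<forall>\<epsilon>>0. \<exists>K. \<forall>\<omega> F. finite F \<and> F \<subseteq> {K..} \<and> (\<forall>n\<in>F. N (\<omega> n) \<le> n) \<longrightarrow>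
      magnitude (coord_proj F (\<lambda>n. from_nat_into D (\<omega> n) * v n)) < \<epsilon>"
    using countable_multiplier_tails_small[OF v_mem, of "from_nat_into D"] ..
  obtain p where p: "\<forall>j. pmf p j > 0" "(\<integral>\<^sup>+j. of_nat (N j) \<partial>measure_pmf p) < \<infinity>"
    using exists_positive_pmf_finite_expectation[of N] by blast
  interpret random_series \<tau> d w T p N "from_nat_into D"
    by unfold_locales (use p v_mem dense N in simp_all)
  show ?thesis
    using sets_law prob_space_law invariant_law exact_law full_support_law by blast
qed

end
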